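(* Let $\Sigma=(X,\mathcal{U},\phi)$ be a control system that is BRS and has the ULIM property with respect to a nonempty bounded (not necessarily $0$-invariant) set $\mathcal{A}\subset X$, and let $\gamma\in\mathcal{K}_\infty$ be a function for which the ULIM property with respect to $\mathcal{A}$ holds. Then for every $\varepsilon>0$ the set $$\mathcal{A}_{\varepsilon,\gamma}:=\{\phi(t,x,u): t\in\mathbb{R}_+,\ x\in B_\varepsilon(\mathcal{A}),\ u\in\mathcal{U},\ \|u\|_{\mathcal{U}}\le\gamma^{-1}(\tfrac{\varepsilon}{2})\}$$ is bounded and $0$-invariant, and $\Sigma$ is CUAG with respect to $\mathcal{A}_{\varepsilon,\gamma}$.
   Context: Notation: $\mathbb{R}_+=[0,\infty)$. For a nonempty subset $\mathcal{A}$ of a normed space $(X,\|\cdot\|)$, $\|x\|_{\mathcal{A}}:=\inf_{y\in\mathcal{A}}\|x-y\|$; $B_r(\mathcal{A})=\{x\in X:\|x\|_{\mathcal{A}}<r\}$. $\mathcal{K}$: continuous strictly increasing $\gamma:\mathbb{R}_+\to\mathbb{R}_+$ with $\gamma(0)=0$; $\mathcal{K}_\infty$: unbounded elements of $\mathcal{K}$; $\mathcal{L}$: continuous strictly decreasing $\gamma:\mathbb{R}_+\to\mathbb{R}_+$ with $\lim_{t\to\infty}\gamma(t)=0$; $\mathcal{KL}$: continuous $\beta:\mathbb{R}_+\times\mathbb{R}_+\to\mathbb{R}_+$ with $\beta(\cdot,t)\in\mathcal{K}$ for all $t\ge0$ and $\beta(r,\cdot)\in\mathcal{L}$ for all $r>0$.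 Control system: a triple $\Sigma=(X,\mathcal{U},\phi)$ where $(X,\|\cdot\|)$ is a normed linear space (state space); $\mathcal{U}\subset\{f:\mathbb{R}_+\to U\}$, with $U$ a nonempty subset of a normed linear space, is a space of inputs with $0\in\mathcal{U}$, endowed with a norm $\|\cdot\|_{\mathcal{U}}$, satisfying: (shift invariance) for all $u\in\mathcal{U}$, $\tau\ge0$: $u(\cdot+\tau)\in\mathcal{U}$ and $\|u(\cdot+\tau)\|_{\mathcal{U}}\le\|u\|_{\mathcal{U}}$; (concatenation) for all $u_1,u_2\in\mathcal{U}$, $t>0$ the function $u$ with $u(\tau)=u_1(\tau)$ for $\tau\in[0,t]$ and $u(\tau)=u_2(\tau-t)$ for $\tau>t$ belongs to $\mathcal{U}$, and if $u_2\equiv0$ then $\|u\|_{\mathcal{U}}\le\|u_1\|_{\mathcal{U}}$; and $\phi:\mathbb{R}_+\times X\times\mathcal{U}\to X$ is a map (defined for all $(t,x,u)$) with: $\phi(0,x,u)=x$; (causality) if $u,\tilde u\in\mathcal{U}$ and $u(s)=\tilde u(s)$ for all $s\in[0,t]$ then $\phi(t,x,u)=\phi(t,x,\tilde u)$; (continuity) $t\mapsto\phi(t,x,u)$ is continuous for each $(x,u)$; (cocycle) $\phi(h,\phi(t,x,u),u(t+\cdot))=\phi(t+h,x,u)$ for all $t,h\ge0$, $x\in X$, $u\in\mathcal{U}$. A set $\mathcal{B}\subset X$ is $0$-invariant if $\phi(t,x,0)\in\mathcal{B}$ for all $t\ge0$, $x\in\mathcal{B}$. BRS (bounded reachability sets):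 for all $C>0$, $\tau>0$: $\sup\{\|\phi(t,x,u)\|:\|x\|\le C,\|u\|_{\mathcal{U}}\le C,t\in[0,\tau]\}<\infty$. ULIM w.r.t. $\mathcal{A}$: there is $\gamma\in\mathcal{K}_\infty$ such that for all $\varepsilon>0$, $r>0$ there is $\tau=\tau(\varepsilon,r)<\infty$ such that for all $u\in\mathcal{U}$ and all $x\in X$ with $\|x\|_{\mathcal{A}}\le r$ there exists $t\le\tau$ ($t\ge 0$) with $\|\phi(t,x,u)\|_{\mathcal{A}}\le\varepsilon+\gamma(\|u\|_{\mathcal{U}})$. CUAG w.r.t. $\mathcal{B}$: there are $\beta\in\mathcal{KL}$, $\tilde\gamma\in\mathcal{K}_\infty$, $C>0$ such that $\|\phi(t,x,u)\|_{\mathcal{B}}\le\beta(\|x\|_{\mathcal{B}}+C,t)+\tilde\gamma(\|u\|_{\mathcal{U}})$ for all $x\in X,u\in\mathcal{U},t\ge0$.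
   Formalization: 0-invariance of A_{ε,γ} is proved only under the added assumption that an input vanishing on (0,∞) yields the same trajectories as the zero input; without it the claim can fail. Boundedness and CUAG need no added assumption. *)

theory Defs
  imports "HOL-Analysis.Analysis"
begin

text \<open>
  Comparison functions. They live on \<open>[0, \<infinity>)\<close>, so every condition is relativised to
  \<open>{0..}\<close> and the values at negative arguments are irrelevant.
\<close>

definition class_K :: "(real \<Rightarrow> real) \<Rightarrow> bool" where
  "class_K g \<longleftrightarrow> g \<in> {0..} \<rightarrow> {0..} \<and> continuous_on {0..} g \<and> strict_mono_on {0..} g \<and> g 0 = 0"

definition class_K_inf :: "(real \<Rightarrow> real) \<Rightarrow> bool" where
  "class_K_inf g \<longleftrightarrow> class_K g \<and> \<not> bdd_above (g ` {0..})"

definition class_L :: "(real \<Rightarrow> real) \<Rightarrow> bool" where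
  "class_L g \<longleftrightarrow> g \<in> {0..} \<rightarrow> {0..} \<and> continuous_on {0..} g \<and> strict_antimono_on {0..} g
     \<and> (g \<longlongrightarrow> 0) at_top"

definition class_KL :: "(real \<Rightarrow> real \<Rightarrow> real) \<Rightarrow> bool" where
  "class_KL \<beta> \<longleftrightarrow> continuous_on ({0..} \<times> {0..}) (\<lambda>(r, t). \<beta> r t)
     \<and> (\<forall>t\<ge>0. class_K (\<lambda>r. \<beta> r t)) \<and> (\<forall>r>0. class_L (\<lambda>t. \<beta> r t))"

text \<open>
  Inputs are functions \<open>[0, \<infinity>) \<rightarrow> V\<close>, represented as elements of the extensional function
  space \<open>{0..} \<rightarrow>\<^sub>E V\<close>, so that equality of inputs is equality on \<open>[0, \<infinity>)\<close>.
\<close>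

definition zero_input :: "real \<Rightarrow> 'u::real_normed_vector" where
  "zero_input = (\<lambda>s\<in>{0..}. 0)"

definition shift_input :: "real \<Rightarrow> (real \<Rightarrow> 'u) \<Rightarrow> (real \<Rightarrow> 'u)" where
  "shift_input \<tau> u = (\<lambda>s\<in>{0..}. u (s + \<tau>))"

definition concat_input :: "(real \<Rightarrow> 'u) \<Rightarrow> real \<Rightarrow> (real \<Rightarrow> 'u) \<Rightarrow> (real \<Rightarrow> 'u)" where
  "concat_input u1 t u2 = (\<lambda>s\<in>{0..}. if s \<le> t then u1 s else u2 (s - t))"

text \<open>
  The input space \<open>U\<close> need not be a linear space (the set \<open>V\<close> of input values is an arbitrary
  nonempty subset of a normed space), so the triangle inequality and the homogeneity of its norm
  \<open>N\<close> are required whenever the sum, respectively the multiple, belongs to \<open>U\<close>.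
  The state space is the whole type \<open>'x\<close>.
\<close>

locale control_system =
  fixes V :: "'u::real_normed_vector set"
    and U :: "(real \<Rightarrow> 'u) set"
    and N :: "(real \<Rightarrow> 'u) \<Rightarrow> real"
    and \<phi> :: "real \<Rightarrow> 'x::real_normed_vector \<Rightarrow> (real \<Rightarrow> 'u) \<Rightarrow> 'x"
  assumes values_nonempty: "V \<noteq> {}"
    and inputs: "U \<subseteq> {0..} \<rightarrow>\<^sub>E V"
    and zero_mem: "zero_input \<in> U"
    and norm_nonneg: "u \<in> U \<Longrightarrow> 0 \<le> N u"
    and norm_eq_0_iff: "u \<in> U \<Longrightarrow> N u = 0 \<longleftrightarrow> u = zero_input"
    and norm_triangle: "\<lbrakk>u1 \<in> U; u2 \<in> U; (\<lambda>s\<in>{0..}. u1 s + u2 s) \<in> U\<rbrakk>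
          \<Longrightarrow> N (\<lambda>s\<in>{0..}. u1 s + u2 s) \<le> N u1 + N u2"
    and norm_scale: "\<lbrakk>u \<in> U; (\<lambda>s\<in>{0..}. c *\<^sub>R u s) \<in> U\<rbrakk>
          \<Longrightarrow> N (\<lambda>s\<in>{0..}. c *\<^sub>R u s) = \<bar>c\<bar> * N u"
    and shift_mem: "\<lbrakk>u \<in> U; 0 \<le> \<tau>\<rbrakk> \<Longrightarrow> shift_input \<tau> u \<in> U"
    and shift_norm: "\<lbrakk>u \<in> U; 0 \<le> \<tau>\<rbrakk> \<Longrightarrow> N (shift_input \<tau> u) \<le> N u"
    and concat_mem: "\<lbrakk>u1 \<in> U; u2 \<in> U; 0 < t\<rbrakk> \<Longrightarrow> concat_input u1 t u2 \<in> U"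
    and concat_norm: "\<lbrakk>u \<in> U; 0 < t\<rbrakk> \<Longrightarrow> N (concat_input u t zero_input) \<le> N u"
    and initial: "u \<in> U \<Longrightarrow> \<phi> 0 x u = x"
    and causal: "\<lbrakk>0 \<le> t; u \<in> U; u' \<in> U; \<And>s. s \<in> {0..t} \<Longrightarrow> u s = u' s\<rbrakk>
          \<Longrightarrow> \<phi> t x u = \<phi> t x u'"
    and continuous: "u \<in> U \<Longrightarrow> continuous_on {0..} (\<lambda>t. \<phi> t x u)"
    and cocycle: "\<lbrakk>0 \<le> t; 0 \<le> h; u \<in> U\<rbrakk>
          \<Longrightarrow> \<phi> h (\<phi> t x u) (shift_input t u) = \<phi> (t + h) x u"

text \<open>
  The distance of \<open>x\<close> to a nonempty set \<open>A\<close> is \<open>infdist x A\<close>.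
\<close>

definition set_ball :: "'x::metric_space set \<Rightarrow> real \<Rightarrow> 'x set" where
  "set_ball A r = {x. infdist x A < r}"

definition zero_invariant ::
  "(real \<Rightarrow> 'x \<Rightarrow> (real \<Rightarrow> 'u::real_normed_vector) \<Rightarrow> 'x) \<Rightarrow> 'x set \<Rightarrow> bool" where
  "zero_invariant \<phi> B \<longleftrightarrow> (\<forall>t\<ge>0. \<forall>x\<in>B. \<phi> t x zero_input \<in> B)"

definition BRS ::
  "(real \<Rightarrow> 'u) set \<Rightarrow> ((real \<Rightarrow> 'u) \<Rightarrow> real) \<Rightarrow>
   (real \<Rightarrow> 'x::real_normed_vector \<Rightarrow> (real \<Rightarrow> 'u) \<Rightarrow> 'x) \<Rightarrow> bool" where
  "BRS U N \<phi> \<longleftrightarrow> (\<forall>C>0. \<forall>\<tau>>0.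
     bdd_above {norm (\<phi> t x u) | t x u. norm x \<le> C \<and> u \<in> U \<and> N u \<le> C \<and> t \<in> {0..\<tau>}})"

text \<open>ULIM with respect to \<open>A\<close>, holding for the specific gain \<open>\<gamma>\<close>.\<close>

definition ULIM_gain ::
  "(real \<Rightarrow> 'u) set \<Rightarrow> ((real \<Rightarrow> 'u) \<Rightarrow> real) \<Rightarrow>
   (real \<Rightarrow> 'x::real_normed_vector \<Rightarrow> (real \<Rightarrow> 'u) \<Rightarrow> 'x) \<Rightarrow> 'x set \<Rightarrow> (real \<Rightarrow> real) \<Rightarrow> bool" where
  "ULIM_gain U N \<phi> A \<gamma> \<longleftrightarrow> class_K_inf \<gamma> \<and>
     (\<forall>\<epsilon>>0. \<forall>r>0. \<exists>\<tau>. \<forall>u\<in>U. \<forall>x. infdist x A \<le> r \<longrightarrow>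
        (\<exists>t. 0 \<le> t \<and> t \<le> \<tau> \<and> infdist (\<phi> t x u) A \<le> \<epsilon> + \<gamma> (N u)))"

definition ULIM ::
  "(real \<Rightarrow> 'u) set \<Rightarrow> ((real \<Rightarrow> 'u) \<Rightarrow> real) \<Rightarrow>
   (real \<Rightarrow> 'x::real_normed_vector \<Rightarrow> (real \<Rightarrow> 'u) \<Rightarrow> 'x) \<Rightarrow> 'x set \<Rightarrow> bool" where
  "ULIM U N \<phi> A \<longleftrightarrow> (\<exists>\<gamma>. ULIM_gain U N \<phi> A \<gamma>)"

definition CUAG ::
  "(real \<Rightarrow> 'u) set \<Rightarrow> ((real \<Rightarrow> 'u) \<Rightarrow> real) \<Rightarrow>
   (real \<Rightarrow> 'x::real_normed_vector \<Rightarrow> (real \<Rightarrow> 'u) \<Rightarrow> 'x) \<Rightarrow> 'x set \<Rightarrow> bool" where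
  "CUAG U N \<phi> B \<longleftrightarrow> (\<exists>\<beta> \<gamma> C. class_KL \<beta> \<and> class_K_inf \<gamma> \<and> C > 0 \<and>
     (\<forall>x. \<forall>u\<in>U. \<forall>t\<ge>0. infdist (\<phi> t x u) B \<le> \<beta> (infdist x B + C) t + \<gamma> (N u)))"

definition reach_set ::
  "(real \<Rightarrow> 'u) set \<Rightarrow> ((real \<Rightarrow> 'u) \<Rightarrow> real) \<Rightarrow>
   (real \<Rightarrow> 'x::real_normed_vector \<Rightarrow> (real \<Rightarrow> 'u) \<Rightarrow> 'x) \<Rightarrow> 'x set \<Rightarrow> real \<Rightarrow> (real \<Rightarrow> real) \<Rightarrow> 'x set" where
  "reach_set U N \<phi> A \<epsilon> \<gamma> =
     {\<phi> t x u | t x u. 0 \<le> t \<and> x \<in> set_ball A \<epsilon> \<and> u \<in> U \<and> N u \<le> inv_into {0..} \<gamma> (\<epsilon> / 2)}"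

text \<open>
  The trajectory under an input that vanishes after time \<open>0\<close> is the trajectory under the zero
  input. The axioms of a control system do not imply this, and \<open>0\<close>-invariance of
  \<open>reach_set\<close> can fail without it: \<open>shift_input t (concat_input u t zero_input)\<close> still has the
  value \<open>u t\<close> at time \<open>0\<close>, so it is not \<open>zero_input\<close> unless \<open>u t = 0\<close>, and causality compares
  inputs on the closed interval \<open>[0, t]\<close>, which contains \<open>0\<close>.
\<close>

definition initial_instant_irrelevant ::
  "(real \<Rightarrow> 'u::real_normed_vector) set \<Rightarrow> (real \<Rightarrow> 'x \<Rightarrow> (real \<Rightarrow> 'u) \<Rightarrow> 'x) \<Rightarrow> bool" where
  "initial_instant_irrelevant U \<phi> \<longleftrightarrow>
     (\<forall>u\<in>U. (\<forall>s>0. u s = 0) \<longrightarrow> (\<forall>t\<ge>0. \<forall>x. \<phi> t x u = \<phi> t x zero_input))"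

end

theory Submission
  imports Defs
begin

text \<open>
  By BRS and ULIM, a trajectory starting in a ball around \<open>A\<close> comes back to it at a time between
  \<open>1\<close> and some \<open>\<tau>\<close>, so that BRS on \<open>[0, \<tau>]\<close> bounds it for all times. Hence
  \<open>A\<^bsub>\<epsilon>,\<gamma>\<^esub>\<close> is bounded. Since the ULIM time does not depend on the input, a trajectory
  starting at distance \<open>\<le> r\<close> from \<open>A\<close> is, after a time \<open>\<theta> r\<close>, inside \<open>A\<^bsub>\<epsilon>,\<gamma>\<^esub>\<close> if
  \<open>\<gamma> (N u) \<le> \<epsilon> / 2\<close>, and otherwise bounded in terms of \<open>N u\<close> alone. The offset \<open>C\<close> in CUAG and
  the lower bound on \<open>N u\<close> in the second case keep the arguments of the bounds away from \<open>0\<close>, so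
  locally bounded functions can be majorised by functions in \<open>\<K>\<^sub>\<infinity>\<close>.
\<close>

section \<open>Comparison functions\<close>

lemma class_K_mono: "class_K g \<Longrightarrow> 0 \<le> r \<Longrightarrow> r \<le> s \<Longrightarrow> g r \<le> g s"
  unfolding class_K_def using strict_mono_on_leD[of "{0..}" g r s] by simp

lemma class_K_less: "class_K g \<Longrightarrow> 0 \<le> r \<Longrightarrow> r < s \<Longrightarrow> g r < g s"
  unfolding class_K_def using strict_mono_onD[of "{0..}" g r s] by simp

lemma class_K_nonneg: "class_K g \<Longrightarrow> 0 \<le> r \<Longrightarrow> 0 \<le> g r"
  unfolding class_K_def by auto

text \<open>Intermediate value theorem between \<open>g 0 = 0\<close> and a value above
  \<open>y\<close>. It puts \<open>\<epsilon> / 2\<close> into the range of the gain.\<close>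

lemma class_K_inf_surj:
  assumes "class_K_inf g" "0 \<le> y"
  shows "y \<in> g ` {0..}"
proof -
  obtain b where b: "0 \<le> b" "y < g b"
    using assms(1) unfolding class_K_inf_def bdd_above_def by (auto simp: not_le)
  have "continuous_on {0..b} g" "g 0 = 0"
    using assms(1) unfolding class_K_inf_def class_K_def
    by (auto intro: continuous_on_subset)
  then obtain x where "0 \<le> x" "x \<le> b" "g x = y"
    using IVT'[of g 0 y b] b assms(2) by auto
  then show ?thesis by auto
qed

lemma class_K_inf_add:
  assumes "class_K_inf f" "class_K_inf g"
  shows "class_K_inf (\<lambda>r. f r + g r)"
proof -
  have K: "class_K f" "class_K g" using assms unfolding class_K_inf_def by auto
  have "class_K (\<lambda>r. f r + g r)"
    unfolding class_K_def
  proof (intro conjI)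
    show "strict_mono_on {0..} (\<lambda>r. f r + g r)"
      by (intro strict_mono_onI add_strict_mono class_K_less[OF K(1)] class_K_less[OF K(2)]) auto
    show "continuous_on {0..} (\<lambda>r. f r + g r)"
      using K unfolding class_K_def by (intro continuous_on_add) blast+
  qed (use K in \<open>auto simp: class_K_def Pi_iff\<close>)
  moreover have "\<not> bdd_above ((\<lambda>r. f r + g r) ` {0..})"
  proof
    assume "bdd_above ((\<lambda>r. f r + g r) ` {0..})"
    then obtain M where M: "f r + g r \<le> M" if "0 \<le> r" for r
      unfolding bdd_above_def by auto
    have "f r \<le> M" if "0 \<le> r" for r
      using M[OF that] class_K_nonneg[OF K(2) that] by linarith
    then have "bdd_above (f ` {0..})" unfolding bdd_above_def by auto
    then show False using assms(1) unfolding class_K_inf_def by simp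
  qed
  ultimately show ?thesis unfolding class_K_inf_def by simp
qed

text \<open>The step function through the values of \<open>f\<close> is dominated by a locally
  finite sum of nonnegative hinge functions, one for each integer.\<close>

lemma continuous_mono_majorant:
  fixes f :: "nat \<Rightarrow> real"
  obtains g :: "real \<Rightarrow> real" where "continuous_on UNIV g" "mono g" "\<And>r. 0 \<le> g r" "\<And>r. 0 \<le> r \<Longrightarrow> f (nat \<lceil>r\<rceil>) \<le> g r"
proof
  \<comment> \<open>The hinge \<open>w n\<close> vanishes for \<open>r \<le> n - 2\<close> and is at
    least \<open>\<bar>f n\<bar>\<close> from \<open>n - 1\<close> on, hence at every
    \<open>r\<close> whose ceiling is \<open>n\<close>.\<close>
  define w where "w n r = \<bar>f n\<bar> * max 0 (r - real n + 2)" for n r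
  define g where "g r = (\<Sum>n. w n r)" for r
  have g_eq: "g r = (\<Sum>n<m. w n r)" if "r + 2 \<le> real m" for r m
    unfolding g_def by (rule suminf_finite) (use that in \<open>auto simp: w_def\<close>)
  have w_nonneg: "0 \<le> w n r" for n r by (simp add: w_def)
  show "continuous_on UNIV g"
  proof (rule continuous_at_imp_continuous_on, rule ballI)
    fix x :: real
    \<comment> \<open>The margin \<open>3\<close> instead of \<open>2\<close> makes one finite sum
      represent \<open>g\<close> on the whole open half-line below \<open>x + 1\<close>, a
      neighbourhood of \<open>x\<close>.\<close>
    obtain m where m: "x + 3 \<le> real m" using real_arch_simple by blast
    have "continuous_on {..<x + 1} (\<lambda>r. \<Sum>n<m. w n r)"
      unfolding w_def by (intro continuous_intros)
    then have "continuous_on {..<x + 1} g"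
      by (rule continuous_on_cong[THEN iffD1, rotated -1]) (use m in \<open>auto intro!: g_eq[symmetric]\<close>)
    then show "isCont g x" by (simp add: continuous_on_eq_continuous_at)
  qed
  show "mono g"
  proof (rule monoI)
    fix r s :: real assume "r \<le> s"
    obtain m where m: "s + 2 \<le> real m" using real_arch_simple by blast
    have "w n r \<le> w n s" for n
      unfolding w_def by (intro mult_left_mono) (use \<open>r \<le> s\<close> in auto)
    then have "(\<Sum>n<m. w n r) \<le> (\<Sum>n<m. w n s)" by (rule sum_mono)
    then show "g r \<le> g s" using g_eq[of r m] g_eq[of s m] m \<open>r \<le> s\<close> by simp
  qed
  fix r :: real
  obtain m where m: "r + 2 \<le> real m" using real_arch_simple by blast
  show "0 \<le> g r" unfolding g_eq[OF m] by (intro sum_nonneg w_nonneg)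
  assume "0 \<le> r"
  have ceil: "real (nat \<lceil>r\<rceil>) \<le> r + 1" using \<open>0 \<le> r\<close> by linarith
  then have "\<bar>f (nat \<lceil>r\<rceil>)\<bar> * 1 \<le> w (nat \<lceil>r\<rceil>) r"
    unfolding w_def by (intro mult_left_mono) auto
  also have "\<dots> \<le> (\<Sum>n<m. w n r)"
    by (rule member_le_sum) (use m ceil w_nonneg in auto)
  finally show "f (nat \<lceil>r\<rceil>) \<le> g r" using g_eq[OF m] by simp
qed

text \<open>Read \<open>P r M\<close> as "\<open>M\<close> is a valid bound at level
  \<open>r\<close>". Bounds chosen at the integers suffice, because a bound at the ceiling of
  \<open>r\<close> is also one at \<open>r\<close>. Such bounds need not tend to \<open>0\<close>
  with \<open>r\<close>, hence the threshold \<open>c\<close>.\<close>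

lemma class_K_inf_majorant:
  fixes P :: "real \<Rightarrow> real \<Rightarrow> bool"
  assumes "0 < c"
    and ex: "\<And>r. 0 < r \<Longrightarrow> \<exists>M. P r M"
    and mono: "\<And>r s M M'. 0 < r \<Longrightarrow> r \<le> s \<Longrightarrow> M \<le> M' \<Longrightarrow> P s M \<Longrightarrow> P r M'"
  obtains \<kappa> where "class_K_inf \<kappa>" "\<And>r. c \<le> r \<Longrightarrow> P r (\<kappa> r)"
proof -
  obtain f where f: "P r (f r)" if "0 < r" for r using ex by metis
  obtain g :: "real \<Rightarrow> real" where g: "continuous_on UNIV g" "mono g" "\<And>r. 0 \<le> g r"
    "\<And>r. 0 \<le> r \<Longrightarrow> f (real (nat \<lceil>r\<rceil>)) \<le> g r"
    using continuous_mono_majorant[of "\<lambda>n. f (real n)"] by metis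
  \<comment> \<open>The factor \<open>r / c\<close> gives the zero at \<open>0\<close>, strict
    growth and unboundedness; it is at least \<open>1\<close> once \<open>c \<le> r\<close>, so the
    bound \<open>g\<close> survives there.\<close>
  define \<kappa> where "\<kappa> r = r / c * (1 + g r)" for r
  have less: "\<kappa> r < \<kappa> s" if "0 \<le> r" "r < s" for r s
    unfolding \<kappa>_def
    by (rule mult_less_le_imp_less)
      (use that \<open>0 < c\<close> g(3)[of r] monoD[OF g(2), of r s] in \<open>auto simp: divide_strict_right_mono\<close>)
  have K: "class_K \<kappa>"
    unfolding class_K_def
  proof (intro conjI)
    show "\<kappa> \<in> {0..} \<rightarrow> {0..}" using \<open>0 < c\<close> g(3) by (auto simp: \<kappa>_def)
    show "continuous_on {0..} \<kappa>"
      unfolding \<kappa>_def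
      by (intro continuous_intros continuous_on_subset[OF g(1)]) (use \<open>0 < c\<close> in auto)
    show "strict_mono_on {0..} \<kappa>" by (auto intro: strict_mono_onI less)
  qed (simp add: \<kappa>_def)
  have "\<not> bdd_above (\<kappa> ` {0..})"
  proof
    assume "bdd_above (\<kappa> ` {0..})"
    then obtain M where M: "\<kappa> r \<le> M" if "0 \<le> r" for r unfolding bdd_above_def by auto
    define r where "r = c * (\<bar>M\<bar> + 1)"
    have "\<bar>M\<bar> + 1 = r / c * 1" using \<open>0 < c\<close> by (simp add: r_def)
    also have "\<dots> \<le> \<kappa> r"
      unfolding \<kappa>_def by (intro mult_left_mono) (use \<open>0 < c\<close> g(3)[of r] in \<open>auto simp: r_def\<close>)
    also have "\<dots> \<le> M" by (rule M) (use \<open>0 < c\<close> in \<open>simp add: r_def\<close>)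
    finally show False by simp
  qed
  then have "class_K_inf \<kappa>" using K by (simp add: class_K_inf_def)
  moreover have "P r (\<kappa> r)" if "c \<le> r" for r
  proof (rule mono)
    show "0 < r" using that \<open>0 < c\<close> by simp
    then show "r \<le> real (nat \<lceil>r\<rceil>)" "P (real (nat \<lceil>r\<rceil>)) (f (real (nat \<lceil>r\<rceil>)))"
      by (linarith, intro f, linarith)
    have "f (real (nat \<lceil>r\<rceil>)) \<le> 1 * (1 + g r)" using g(4)[of r] \<open>0 < r\<close> by simp
    also have "\<dots> \<le> \<kappa> r"
      unfolding \<kappa>_def by (rule mult_right_mono) (use that \<open>0 < c\<close> g(3)[of r] in auto)
    finally show "f (real (nat \<lceil>r\<rceil>)) \<le> \<kappa> r" .
  qed
  ultimately show ?thesis using that by blast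
qed

text \<open>The shape of the decay estimate: the exponential is at least \<open>1\<close> as long as
  \<open>t \<le> \<theta> r\<close>, so a bound \<open>\<kappa> r\<close> valid up to time
  \<open>\<theta> r\<close> is preserved, and afterwards the product tends to
  \<open>0\<close>.\<close>

lemma class_KL_mult_exp:
  assumes \<kappa>: "class_K \<kappa>" and \<theta>: "class_K \<theta>"
  shows "class_KL (\<lambda>r t. \<kappa> r * exp (\<theta> r - t))"
  unfolding class_KL_def
proof (intro conjI allI impI)
  have c: "continuous_on {0..} \<kappa>" "continuous_on {0..} \<theta>"
    using \<kappa> \<theta> by (auto simp: class_K_def)
  have "continuous_on ({0..} \<times> {0..}) (\<lambda>p. \<kappa> (fst p) * exp (\<theta> (fst p) - snd p) :: real)"
    by (intro continuous_intros continuous_on_compose2[OF c(1)] continuous_on_compose2[OF c(2)])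
      auto
  then show "continuous_on ({0..} \<times> {0..}) (\<lambda>(r, t). \<kappa> r * exp (\<theta> r - t))"
    by (simp add: case_prod_unfold)
  show "class_K (\<lambda>r. \<kappa> r * exp (\<theta> r - t))" for t
    unfolding class_K_def
  proof (intro conjI)
    show "continuous_on {0..} (\<lambda>r. \<kappa> r * exp (\<theta> r - t))" by (intro continuous_intros c)
    show "strict_mono_on {0..} (\<lambda>r. \<kappa> r * exp (\<theta> r - t))"
      by (rule strict_mono_onI, rule mult_less_le_imp_less)
        (auto intro: class_K_less[OF \<kappa>] class_K_mono[OF \<theta>] class_K_nonneg[OF \<kappa>])
  qed (use \<kappa> class_K_nonneg[OF \<kappa>] in \<open>auto simp: class_K_def\<close>)
  fix r :: real assume "0 < r"
  then have pos: "0 < \<kappa> r" using class_K_less[OF \<kappa>, of 0 r] \<kappa> by (simp add: class_K_def)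
  have "((\<lambda>t. \<kappa> r * exp (\<theta> r) * exp (- t)) \<longlongrightarrow> \<kappa> r * exp (\<theta> r) * 0) at_top"
    by (intro tendsto_intros filterlim_compose[OF exp_at_bot filterlim_uminus_at_bot_at_top])
  then have "((\<lambda>t. \<kappa> r * exp (\<theta> r - t)) \<longlongrightarrow> 0) at_top"
    by (simp add: exp_diff exp_minus divide_inverse mult.assoc)
  then show "class_L (\<lambda>t. \<kappa> r * exp (\<theta> r - t))"
    unfolding class_L_def using pos
    by (auto intro!: continuous_intros monotone_onI)
qed

section \<open>Trajectories\<close>

text \<open>Translates between BRS, stated with norms, and ULIM, stated with distances to
  \<open>A\<close>; \<open>D\<close> bounds the norms of the points of \<open>A\<close>.\<close>

lemma norm_le_infdist:
  fixes A :: "'a::real_normed_vector set"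
  assumes "A \<noteq> {}" "bounded A"
  obtains D where "0 \<le> D" "\<And>x. norm x \<le> infdist x A + D"
proof -
  obtain D where D: "norm a \<le> D" if "a \<in> A" for a using assms(2) bounded_iff by blast
  have "norm x \<le> infdist x A + D" for x
  proof -
    have "norm x - D \<le> dist x b" if "b \<in> A" for b
      using norm_triangle_sub[of x b] D[OF that] by (simp add: dist_norm)
    then have "norm x - D \<le> infdist x A"
      unfolding infdist_notempty[OF assms(1)] by (intro cINF_greatest assms(1))
    then show ?thesis by simp
  qed
  moreover have "0 \<le> D" using D assms(1) norm_ge_zero order_trans by blast
  ultimately show ?thesis using that by blast
qed

context control_system
begin

lemma trajectory_split:
  assumes "u \<in> U" "0 \<le> s" "s \<le> t"
  shows "\<phi> t x u = \<phi> (t - s) (\<phi> s x u) (shift_input s u)"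
  using cocycle[of s "t - s" u x] assms by simp

lemma BRS_infdist:
  assumes "BRS U N \<phi>" "A \<noteq> {}" "bounded A" "0 < R"
  shows "\<exists>M>0. \<forall>x. \<forall>u\<in>U. \<forall>t\<in>{0..\<tau>}. infdist x A \<le> R \<longrightarrow> N u \<le> R \<longrightarrow> infdist (\<phi> t x u) A \<le> M"
proof -
  obtain D where D: "0 \<le> D" "\<And>x. norm x \<le> infdist x A + D"
    using norm_le_infdist[OF assms(2,3)] by blast
  obtain a where a: "a \<in> A" using assms(2) by blast
  \<comment> \<open>BRS asks for a positive horizon while \<open>\<tau>\<close> is arbitrary, hence
    \<open>max \<tau> 1\<close>.\<close>
  have "bdd_above {norm (\<phi> t x u) | t x u. norm x \<le> R + D \<and> u \<in> U \<and> N u \<le> R + D \<and> t \<in> {0..max \<tau> 1}}"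
    using assms(1,4) D(1) unfolding BRS_def by simp
  then obtain M where M: "norm (\<phi> t x u) \<le> M"
    if "norm x \<le> R + D" "u \<in> U" "N u \<le> R + D" "t \<in> {0..max \<tau> 1}" for t x u
    unfolding bdd_above_def by blast
  \<comment> \<open>The summand \<open>D\<close> absorbs \<open>norm a\<close>; the absolute value
    and the \<open>1\<close> make the bound positive, so that it can serve as a radius in
    ULIM.\<close>
  have "infdist (\<phi> t x u) A \<le> \<bar>M\<bar> + D + 1"
    if "u \<in> U" "t \<in> {0..\<tau>}" "infdist x A \<le> R" "N u \<le> R" for t x u
  proof -
    have "infdist (\<phi> t x u) A \<le> norm (\<phi> t x u) + norm a"
      using infdist_le[OF a, of "\<phi> t x u"] norm_triangle_ineq4[of "\<phi> t x u" a]
      by (simp add: dist_norm)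
    moreover have "norm (\<phi> t x u) \<le> M"
      using that D(1) D(2)[of x] by (intro M) auto
    ultimately show ?thesis using D(2)[of a] a by simp
  qed
  then show ?thesis using D(1) by (intro exI[of _ "\<bar>M\<bar> + D + 1"]) auto
qed

text \<open>BRS controls finite horizons only. Trajectories keep returning to the
  \<open>R\<close>-neighbourhood of \<open>A\<close> with gaps of at most \<open>1 + \<tau>\<close>,
  so BRS on one gap, restarted at each return, covers all times.\<close>

lemma uniformly_bounded:
  assumes BRS: "BRS U N \<phi>" and A: "A \<noteq> {}" "bounded A" and ULIM: "ULIM_gain U N \<phi> A \<gamma>"
    and "0 < r"
  shows "\<exists>M. \<forall>x. \<forall>u\<in>U. \<forall>t\<ge>0. infdist x A \<le> r \<longrightarrow> N u \<le> r \<longrightarrow> infdist (\<phi> t x u) A \<le> M"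
proof -
  have K: "class_K \<gamma>" using ULIM by (simp add: ULIM_gain_def class_K_inf_def)
  \<comment> \<open>Large enough for the initial states and inputs, and for the level
    \<open>1 + \<gamma> r\<close> that ULIM reaches with tolerance \<open>1\<close>.\<close>
  define R where "R = max r (1 + \<gamma> r)"
  have R: "0 < R" "r \<le> R" "1 + \<gamma> r \<le> R" using \<open>0 < r\<close> by (auto simp: R_def)
  obtain M1 where M1: "0 < M1" "\<And>x u. u \<in> U \<Longrightarrow> infdist x A \<le> R \<Longrightarrow> N u \<le> R \<Longrightarrow> infdist (\<phi> 1 x u) A \<le> M1"
    using BRS_infdist[OF BRS A R(1), of 1] by force
  obtain \<tau> where \<tau>: "\<And>u x. u \<in> U \<Longrightarrow> infdist x A \<le> M1 \<Longrightarrow>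
      \<exists>t. 0 \<le> t \<and> t \<le> \<tau> \<and> infdist (\<phi> t x u) A \<le> 1 + \<gamma> (N u)"
    using ULIM M1(1) unfolding ULIM_gain_def by (meson zero_less_one)
  \<comment> \<open>ULIM alone might give the return time \<open>0\<close>. Running for time
    \<open>1\<close> first, and applying ULIM from the radius \<open>M1\<close> reached then, forces
    progress.\<close>
  have return: "\<exists>t\<in>{1..1 + \<tau>}. infdist (\<phi> t x u) A \<le> R"
    if u: "u \<in> U" "infdist x A \<le> R" "N u \<le> r" for x u
  proof -
    have sh: "shift_input 1 u \<in> U" "N (shift_input 1 u) \<le> r"
      using shift_mem[OF u(1), of 1] shift_norm[OF u(1), of 1] u(3) by auto
    obtain t where t: "0 \<le> t" "t \<le> \<tau>"
      "infdist (\<phi> t (\<phi> 1 x u) (shift_input 1 u)) A \<le> 1 + \<gamma> (N (shift_input 1 u))"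
      using \<tau>[OF sh(1) M1(2)[OF u(1,2)]] u(3) R(2) by auto
    have "\<gamma> (N (shift_input 1 u)) \<le> \<gamma> r"
      using class_K_mono[OF K norm_nonneg] sh by blast
    moreover have "\<phi> t (\<phi> 1 x u) (shift_input 1 u) = \<phi> (1 + t) x u"
      using cocycle[of 1 t u x] t u by simp
    ultimately show ?thesis using t R(3) by (intro bexI[of _ "1 + t"]) auto
  qed
  obtain M where M: "\<And>x u t. u \<in> U \<Longrightarrow> t \<in> {0..1 + \<tau>} \<Longrightarrow> infdist x A \<le> R \<Longrightarrow> N u \<le> R
      \<Longrightarrow> infdist (\<phi> t x u) A \<le> M"
    using BRS_infdist[OF BRS A R(1), of "1 + \<tau>"] by metis
  \<comment> \<open>Each return consumes at least one unit of time, so induction on an integer bound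
    for \<open>t\<close> works.\<close>
  have bound: "infdist (\<phi> t x u) A \<le> M"
    if "u \<in> U" "0 \<le> t" "t \<le> real n" "infdist x A \<le> R" "N u \<le> r" for n x u t
    using that
  proof (induction n arbitrary: x u t)
    case 0
    \<comment> \<open>The existence of a return time shows \<open>0 \<le> 1 + \<tau>\<close>; the
      sign of \<open>\<tau>\<close> is not given by ULIM.\<close>
    obtain s where "s \<in> {1..1 + \<tau>}" using return 0 by blast
    then show ?case using 0 R(2) by (intro M) auto
  next
    case (Suc n)
    show ?case
    proof (cases "t \<le> 1 + \<tau>")
      case True
      then show ?thesis using Suc.prems R(2) by (intro M) auto
    next
      case False
      obtain s where s: "s \<in> {1..1 + \<tau>}" "infdist (\<phi> s x u) A \<le> R"
        using return Suc.prems by blast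
      have "infdist (\<phi> (t - s) (\<phi> s x u) (shift_input s u)) A \<le> M"
        using shift_mem[of u s] shift_norm[of u s] Suc.prems s False
        by (intro Suc.IH) auto
      then show ?thesis using trajectory_split[of u s t x] Suc.prems s False by simp
    qed
  qed
  have "infdist (\<phi> t x u) A \<le> M"
    if "u \<in> U" "0 \<le> t" "infdist x A \<le> r" "N u \<le> r" for x u t
    using bound[of u t "nat \<lceil>t\<rceil>"] that R(2) by (simp add: real_nat_ceiling_ge)
  then show ?thesis by blast
qed

section \<open>The reachable set: invariance, boundedness, CUAG\<close>

text \<open>Continuing from \<open>\<phi> t x u\<close> with zero input is the same as running from
  \<open>x\<close> with \<open>u\<close> cut off after \<open>t\<close>, and cutting off does not
  increase the norm.\<close>

lemma zero_invariant_reach_set: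
  assumes "initial_instant_irrelevant U \<phi>" "0 \<le> inv_into {0..} \<gamma> (\<epsilon> / 2)"
  shows "zero_invariant \<phi> (reach_set U N \<phi> A \<epsilon> \<gamma>)"
  unfolding zero_invariant_def
proof (intro allI impI ballI)
  fix s y assume "(0::real) \<le> s" "y \<in> reach_set U N \<phi> A \<epsilon> \<gamma>"
  then obtain t x u where y: "y = \<phi> t x u" and *: "0 \<le> t" "x \<in> set_ball A \<epsilon>" "u \<in> U"
    "N u \<le> inv_into {0..} \<gamma> (\<epsilon> / 2)"
    unfolding reach_set_def by blast
  show "\<phi> s y zero_input \<in> reach_set U N \<phi> A \<epsilon> \<gamma>"
  \<comment> \<open>Concatenation is available at positive times only; at \<open>t = 0\<close> the
    zero input itself is admissible.\<close>
  proof (cases "t = 0")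
    case True
    have "N zero_input = 0" using norm_eq_0_iff[OF zero_mem] by simp
    then have "N zero_input \<le> inv_into {0..} \<gamma> (\<epsilon> / 2)" using assms(2) by simp
    moreover have "y = x" using True y * initial by simp
    ultimately show ?thesis
      using * zero_mem \<open>0 \<le> s\<close> unfolding reach_set_def by blast
  next
    case False
    then have t: "0 < t" using * by simp
    define w where "w = concat_input u t zero_input"
    have w: "w \<in> U" "N w \<le> inv_into {0..} \<gamma> (\<epsilon> / 2)"
      using concat_mem[OF *(3) zero_mem t] concat_norm[OF *(3) t] * by (auto simp: w_def)
    have "\<phi> t x u = \<phi> t x w"
      using * w by (intro causal) (auto simp: w_def concat_input_def)
    \<comment> \<open>The shifted input vanishes on \<open>s > 0\<close> but keeps the value
      \<open>u t\<close> at \<open>0\<close>; this is where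
      \<open>initial_instant_irrelevant\<close> enters.\<close>
    moreover have "\<phi> s (\<phi> t x w) (shift_input t w) = \<phi> s (\<phi> t x w) zero_input"
      using assms(1) shift_mem[OF w(1), of t] t \<open>0 \<le> s\<close> unfolding initial_instant_irrelevant_def
      by (auto simp: shift_input_def w_def concat_input_def zero_input_def)
    ultimately have "\<phi> s y zero_input = \<phi> (t + s) x w"
      using cocycle[of t s w x] w t \<open>0 \<le> s\<close> y by simp
    then show ?thesis
      using w * \<open>0 \<le> s\<close> unfolding reach_set_def
      by (auto intro!: exI[of _ "t + s"] exI[of _ x] exI[of _ w])
  qed
qed

text \<open>Uniform boundedness at a level covering both the radius \<open>\<epsilon>\<close> and
  the input bound. The constant is made positive because it becomes the offset in CUAG.\<close>

lemma bounded_reach_set: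
  assumes "BRS U N \<phi>" "A \<noteq> {}" "bounded A" "ULIM_gain U N \<phi> A \<gamma>" "0 < \<epsilon>"
  obtains D where "0 < D" "\<And>y. y \<in> reach_set U N \<phi> A \<epsilon> \<gamma> \<Longrightarrow> infdist y A \<le> D"
proof -
  define r where "r = max \<epsilon> (inv_into {0..} \<gamma> (\<epsilon> / 2))"
  have "0 < r" using assms(5) by (simp add: r_def)
  then obtain M where M: "\<And>x u t. u \<in> U \<Longrightarrow> 0 \<le> t \<Longrightarrow> infdist x A \<le> r \<Longrightarrow> N u \<le> r
      \<Longrightarrow> infdist (\<phi> t x u) A \<le> M"
    using uniformly_bounded[OF assms(1-4)] by metis
  have "infdist y A \<le> \<bar>M\<bar> + 1" if "y \<in> reach_set U N \<phi> A \<epsilon> \<gamma>" for y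
  proof -
    obtain t x u where "y = \<phi> t x u" "0 \<le> t" "infdist x A < \<epsilon>" "u \<in> U"
      "N u \<le> inv_into {0..} \<gamma> (\<epsilon> / 2)"
      using \<open>y \<in> _\<close> unfolding reach_set_def set_ball_def by blast
    then have "infdist y A \<le> M" using M[of u t x] by (simp add: r_def)
    then show ?thesis by linarith
  qed
  then show ?thesis using that[of "\<bar>M\<bar> + 1"] by simp
qed

lemma CUAG_reach_set:
  assumes BRS: "BRS U N \<phi>" and A: "A \<noteq> {}" "bounded A" and ULIM: "ULIM_gain U N \<phi> A \<gamma>"
    and "0 < \<epsilon>" and \<delta>_def: "\<delta> = inv_into {0..} \<gamma> (\<epsilon> / 2)" and \<delta>: "0 < \<delta>" "\<gamma> \<delta> = \<epsilon> / 2"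
  shows "CUAG U N \<phi> (reach_set U N \<phi> A \<epsilon> \<gamma>)"
proof -
  define B where "B = reach_set U N \<phi> A \<epsilon> \<gamma>"
  have BI: "\<phi> t x u \<in> B" if "0 \<le> t" "infdist x A < \<epsilon>" "u \<in> U" "N u \<le> \<delta>" for t x u
    using that unfolding B_def reach_set_def set_ball_def \<delta>_def by blast
  have N0: "N zero_input = 0" using norm_eq_0_iff[OF zero_mem] by simp
  have AB: "A \<subseteq> B"
  proof
    fix a assume "a \<in> A"
    then show "a \<in> B"
      using BI[of 0 a zero_input] \<open>0 < \<epsilon>\<close> \<delta>(1) zero_mem N0 initial by simp
  qed
  then have "B \<noteq> {}" using A by blast
  have B_le_A: "infdist x B \<le> infdist x A" for x by (rule infdist_mono[OF AB A(1)])
  obtain C where C: "0 < C" "\<And>y. y \<in> B \<Longrightarrow> infdist y A \<le> C"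
    using bounded_reach_set[OF BRS A ULIM \<open>0 < \<epsilon>\<close>] unfolding B_def by blast
  have A_le_B: "infdist x A \<le> infdist x B + C" for x
  proof -
    have "infdist x A - C \<le> dist x b" if "b \<in> B" for b
      using infdist_triangle[of x A b] C(2)[OF that] by linarith
    then have "infdist x A - C \<le> infdist x B"
      unfolding infdist_notempty[OF \<open>B \<noteq> {}\<close>] by (intro cINF_greatest \<open>B \<noteq> {}\<close>)
    then show ?thesis by simp
  qed
  have K: "class_K \<gamma>" using ULIM by (simp add: ULIM_gain_def class_K_inf_def)
  \<comment> \<open>One threshold for both uses of the majorants: \<open>infdist x B + C\<close> is
    at least \<open>C\<close>, and large inputs have norm above \<open>\<delta>\<close>.\<close>
  define c where "c = min C \<delta>"
  have c: "0 < c" "c \<le> C" "c \<le> \<delta>" using C(1) \<delta>(1) by (auto simp: c_def)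
  \<comment> \<open>Used twice: \<open>h r = r\<close> bounds the trajectory from its start,
    \<open>h r = \<epsilon> / 4 + \<gamma> r\<close> bounds it after ULIM has brought it near
    \<open>A\<close>.\<close>
  have bound: "\<exists>\<kappa>. class_K_inf \<kappa> \<and> (\<forall>r\<ge>c. \<forall>x. \<forall>u\<in>U. \<forall>t\<ge>0. infdist x A \<le> h r \<longrightarrow> N u \<le> r
      \<longrightarrow> infdist (\<phi> t x u) B \<le> \<kappa> r)"
    if h: "\<And>r s. 0 < r \<Longrightarrow> r \<le> s \<Longrightarrow> h r \<le> h s" for h :: "real \<Rightarrow> real"
  proof -
    define P where "P r M \<longleftrightarrow> (\<forall>x. \<forall>u\<in>U. \<forall>t\<ge>0. infdist x A \<le> h r \<longrightarrow> N u \<le> r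
      \<longrightarrow> infdist (\<phi> t x u) B \<le> M)" for r M
    have "\<exists>M. P r M" if "0 < r" for r
    proof -
      have "0 < max r (h r)" using that by simp
      then obtain M where M: "\<forall>x. \<forall>u\<in>U. \<forall>t\<ge>0. infdist x A \<le> max r (h r) \<longrightarrow> N u \<le> max r (h r)
          \<longrightarrow> infdist (\<phi> t x u) A \<le> M"
        using uniformly_bounded[OF BRS A ULIM] by blast
      have "P r M"
        unfolding P_def
      proof (intro allI ballI impI)
        fix x u t assume "u \<in> U" "(0::real) \<le> t" "infdist x A \<le> h r" "N u \<le> r"
        then have "infdist (\<phi> t x u) A \<le> M" using M by (simp add: le_max_iff_disj)
        then show "infdist (\<phi> t x u) B \<le> M" using B_le_A order_trans by blast
      qed
      then show ?thesis ..
    qed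
    moreover have "P r M'" if "0 < r" "r \<le> s" "M \<le> M'" "P s M" for r s M M'
      unfolding P_def
    proof (intro allI ballI impI)
      fix x u t assume *: "u \<in> U" "(0::real) \<le> t" "infdist x A \<le> h r" "N u \<le> r"
      then have "infdist x A \<le> h s" "N u \<le> s" using h[OF that(1,2)] that(2) by linarith+
      then have "infdist (\<phi> t x u) B \<le> M" using that(4) * unfolding P_def by blast
      then show "infdist (\<phi> t x u) B \<le> M'" using that(3) by linarith
    qed
    ultimately obtain \<kappa> where "class_K_inf \<kappa>" "\<And>r. c \<le> r \<Longrightarrow> P r (\<kappa> r)"
      using class_K_inf_majorant[OF c(1), of P] by blast
    then show ?thesis unfolding P_def by blast
  qed
  obtain \<kappa> where \<kappa>: "class_K_inf \<kappa>" "\<And>r x u t. c \<le> r \<Longrightarrow> u \<in> U \<Longrightarrow> 0 \<le> t \<Longrightarrow> infdist x A \<le> r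
      \<Longrightarrow> N u \<le> r \<Longrightarrow> infdist (\<phi> t x u) B \<le> \<kappa> r"
    using bound[of "\<lambda>r. r"] by blast
  have "\<epsilon> / 4 + \<gamma> r \<le> \<epsilon> / 4 + \<gamma> s" if "0 < r" "r \<le> s" for r s
    using class_K_mono[OF K, of r s] that by simp
  from bound[of "\<lambda>r. \<epsilon> / 4 + \<gamma> r", OF this]
  obtain \<rho> where \<rho>: "class_K_inf \<rho>" "\<And>r x u t. c \<le> r \<Longrightarrow> u \<in> U \<Longrightarrow> 0 \<le> t
      \<Longrightarrow> infdist x A \<le> \<epsilon> / 4 + \<gamma> r \<Longrightarrow> N u \<le> r \<Longrightarrow> infdist (\<phi> t x u) B \<le> \<rho> r"
    by blast
  \<comment> \<open>The tolerance \<open>\<epsilon> / 4\<close> leaves room: with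
    \<open>\<gamma> (N u) \<le> \<epsilon> / 2\<close> the distance is at most
    \<open>3 / 4 * \<epsilon>\<close>, strictly inside the open ball of radius
    \<open>\<epsilon>\<close>.\<close>
  define Q where "Q r \<tau> \<longleftrightarrow> (\<forall>u\<in>U. \<forall>x. infdist x A \<le> r \<longrightarrow>
      (\<exists>t. 0 \<le> t \<and> t \<le> \<tau> \<and> infdist (\<phi> t x u) A \<le> \<epsilon> / 4 + \<gamma> (N u)))" for r \<tau>
  have "\<exists>\<tau>. Q r \<tau>" if "0 < r" for r
    using ULIM \<open>0 < \<epsilon>\<close> that unfolding ULIM_gain_def Q_def by simp
  moreover have "Q r \<tau>'" if "r \<le> s" "\<tau> \<le> \<tau>'" "Q s \<tau>" for r s \<tau> \<tau>'
    using that(3) order_trans[OF _ that(1)] order_trans[OF _ that(2)] unfolding Q_def by blast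
  ultimately obtain \<theta> where \<theta>: "class_K_inf \<theta>" "\<And>r. c \<le> r \<Longrightarrow> Q r (\<theta> r)"
    using class_K_inf_majorant[OF c(1), of Q] by blast
  have K': "class_K \<kappa>" "class_K \<theta>" "class_K \<rho>"
    using \<kappa>(1) \<theta>(1) \<rho>(1) by (auto simp: class_K_inf_def)
  have main: "infdist (\<phi> t x u) B \<le> \<kappa> (infdist x B + C) * exp (\<theta> (infdist x B + C) - t) + (\<kappa> (N u) + \<rho> (N u))"
    if ut: "u \<in> U" "0 \<le> t" for x u t
  proof -
    define r where "r = infdist x B + C"
    have r: "infdist x A \<le> r" "c \<le> r"
      using A_le_B[of x] infdist_nonneg[of x B] c by (auto simp: r_def)
    have nn: "0 \<le> \<kappa> r" "0 \<le> \<kappa> (N u)" "0 \<le> \<rho> (N u)"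
      using class_K_nonneg K' norm_nonneg[OF ut(1)] r(2) c(1) by auto
    then have nn': "0 \<le> \<kappa> r * exp (\<theta> r - t)" by simp
    have "infdist (\<phi> t x u) B \<le> \<kappa> r * exp (\<theta> r - t) + (\<kappa> (N u) + \<rho> (N u))"
    proof (cases "t \<le> \<theta> r")
      case True
      show ?thesis
      proof (cases "N u \<le> r")
        case le: True
        have "infdist (\<phi> t x u) B \<le> \<kappa> r * 1" using \<kappa>(2)[OF r(2) ut r(1) le] by simp
        also have "\<dots> \<le> \<kappa> r * exp (\<theta> r - t)" by (rule mult_left_mono) (use True nn in auto)
        finally show ?thesis using nn by linarith
      next
        case False
        \<comment> \<open>Now \<open>r < N u\<close>, so \<open>N u\<close> itself is a level
          dominating both the initial distance and the input.\<close>
        then have "infdist (\<phi> t x u) B \<le> \<kappa> (N u)" using \<kappa>(2)[of "N u" u t x] r ut by simp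
        then show ?thesis using nn nn' by linarith
      qed
    next
      case False
      obtain s where s: "0 \<le> s" "s \<le> \<theta> r" "infdist (\<phi> s x u) A \<le> \<epsilon> / 4 + \<gamma> (N u)"
        using \<theta>(2)[OF r(2), unfolded Q_def, rule_format, OF ut(1) r(1)] by blast
      have sp: "\<phi> t x u = \<phi> (t - s) (\<phi> s x u) (shift_input s u)"
        using trajectory_split[of u s t x] ut s False by simp
      have sh: "shift_input s u \<in> U" "N (shift_input s u) \<le> N u"
        using shift_mem shift_norm ut s by auto
      show ?thesis
      proof (cases "N u \<le> \<delta>")
        case True
        then have "\<gamma> (N u) \<le> \<epsilon> / 2" using class_K_mono[OF K norm_nonneg[OF ut(1)] True] \<delta>(2) by simp
        \<comment> \<open>At time \<open>s\<close> the state lies in the ball that generates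
          \<open>B\<close> and the remaining input is small, so the rest of the trajectory is in
          \<open>B\<close> by definition.\<close>
        then have "\<phi> t x u \<in> B"
          unfolding sp using s sh True False \<open>0 < \<epsilon>\<close> by (intro BI) auto
        then show ?thesis using nn nn' by simp
      next
        case False
        \<comment> \<open>Here \<open>c \<le> \<delta> < N u\<close>, so \<open>\<rho>\<close>
          applies at level \<open>N u\<close>, independently of \<open>r\<close>.\<close>
        then have "infdist (\<phi> t x u) B \<le> \<rho> (N u)"
          unfolding sp using s sh c \<open>\<not> t \<le> \<theta> r\<close> by (intro \<rho>(2)) auto
        then show ?thesis using nn nn' by linarith
      qed
    qed
    then show ?thesis by (simp add: r_def)
  qed
  show ?thesis
    unfolding CUAG_def B_def[symmetric]
    using class_KL_mult_exp[OF K'(1,2)] class_K_inf_add[OF \<kappa>(1) \<rho>(1)] C(1) main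
    by (intro exI[of _ "\<lambda>r t. \<kappa> r * exp (\<theta> r - t)"] exI[of _ "\<lambda>s. \<kappa> s + \<rho> s"] exI[of _ C])
      simp
qed

end

theorem mainTheorem3:
  fixes V :: "'u::real_normed_vector set"
    and U :: "(real \<Rightarrow> 'u) set"
    and N :: "(real \<Rightarrow> 'u) \<Rightarrow> real"
    and \<phi> :: "real \<Rightarrow> 'x::real_normed_vector \<Rightarrow> (real \<Rightarrow> 'u) \<Rightarrow> 'x"
    and A :: "'x set"
    and \<gamma> :: "real \<Rightarrow> real"
  assumes "control_system V U N \<phi>"
    and "BRS U N \<phi>"
    and "A \<noteq> {}" and "bounded A"
    and "ULIM U N \<phi> A"
    and "ULIM_gain U N \<phi> A \<gamma>"
  shows "\<forall>\<epsilon>>0. bounded (reach_set U N \<phi> A \<epsilon> \<gamma>)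
           \<and> (initial_instant_irrelevant U \<phi> \<longrightarrow> zero_invariant \<phi> (reach_set U N \<phi> A \<epsilon> \<gamma>))
           \<and> CUAG U N \<phi> (reach_set U N \<phi> A \<epsilon> \<gamma>)"
proof (intro allI impI conjI)
  interpret control_system V U N \<phi> by (rule assms(1))
  fix \<epsilon> :: real assume "0 < \<epsilon>"
  define \<delta> where "\<delta> = inv_into {0..} \<gamma> (\<epsilon> / 2)"
  have K: "class_K_inf \<gamma>" using assms(6) by (simp add: ULIM_gain_def)
  \<comment> \<open>Membership in the range is what makes \<open>inv_into\<close> return a true
    preimage instead of an arbitrary value.\<close>
  have mem: "\<epsilon> / 2 \<in> \<gamma> ` {0..}" using class_K_inf_surj[OF K] \<open>0 < \<epsilon>\<close> by simp
  have \<gamma>\<delta>: "\<gamma> \<delta> = \<epsilon> / 2" and "0 \<le> \<delta>"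
    using f_inv_into_f[OF mem] inv_into_into[OF mem] by (auto simp: \<delta>_def)
  have "\<delta> \<noteq> 0" using \<gamma>\<delta> K \<open>0 < \<epsilon>\<close> by (auto simp: class_K_inf_def class_K_def)
  then have "0 < \<delta>" using \<open>0 \<le> \<delta>\<close> by simp
  show "CUAG U N \<phi> (reach_set U N \<phi> A \<epsilon> \<gamma>)"
    using CUAG_reach_set[OF assms(2-4,6) \<open>0 < \<epsilon>\<close> \<delta>_def \<open>0 < \<delta>\<close> \<gamma>\<delta>] .
  show "zero_invariant \<phi> (reach_set U N \<phi> A \<epsilon> \<gamma>)" if "initial_instant_irrelevant U \<phi>"
    using zero_invariant_reach_set[OF that] \<open>0 \<le> \<delta>\<close> unfolding \<delta>_def .
  obtain D where D: "\<And>y. y \<in> reach_set U N \<phi> A \<epsilon> \<gamma> \<Longrightarrow> infdist y A \<le> D"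
    using bounded_reach_set[OF assms(2-4,6) \<open>0 < \<epsilon>\<close>] by blast
  obtain D' where D': "\<And>y. norm y \<le> infdist y A + D'"
    using norm_le_infdist[OF assms(3,4)] by blast
  have "norm y \<le> D + D'" if "y \<in> reach_set U N \<phi> A \<epsilon> \<gamma>" for y
    using D[OF that] D'[of y] by linarith
  then show "bounded (reach_set U N \<phi> A \<epsilon> \<gamma>)"
    unfolding bounded_iff by blast
qed

end
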